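(* Let $\mathcal{E}$ be an ellipse with semi-axes $a,b>0$. For every point $M$ on $\mathcal{E}$, the signed area $A^\dagger$ of the pseudo Talbot curve $\mathcal{E}^\dagger$ of $\mathcal{E}$ with respect to $M$ does not depend on $M$ and is given by $$A^\dagger=-\frac{\pi\,(3a^4+2a^2b^2+3b^4)\,(a^2-2ab-b^2)\,(a^2+2ab-b^2)}{8a^3b^3}.$$
   Context: Parametrize $\mathcal{E}$ by $P(t)=(a\cos t,b\sin t)$, $t\in[0,2\pi]$. Given $M$ on $\mathcal{E}$, let $\mathcal{L}(t)$ be the line through $P(t)$ perpendicular to $P(t)-M$. The hybrid pedal curve $\mathcal{E}^*$ is the locus of the intersection $Q^*(t)$ of $\mathcal{L}(t)$ with the line through $M$ perpendicular to $P'(t)$ (the line joining $M$ to the foot of its perpendicular on the tangent at $P(t)$); at the single parameter value with $P(t)=M$, $Q^*(t)$ is defined by continuity. The negative pedal curve, with respect to $M$, of a parametrized curve $X(t)$ is the envelope of the lines through $X(t)$ perpendicular to $X(t)-M$, parametrized by $t$. The pseudo Talbot curve $\mathcal{E}^\dagger$ is the negative pedal curve of $\mathcal{E}^*$ (parametrized by $t\mapsto Q^*(t)$) with respect to $M$. The signed area of a closed parametrized curve $\gamma$ is $\frac12\int_\gamma(x\,dy-y\,dx)$, with orientation given by increasing $t$ (so that $\mathcal{E}$ itself has area $+\pi ab$). *)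

theory Defs
  imports "HOL-Analysis.Analysis"
begin

definition ellipse :: "real \<Rightarrow> real \<Rightarrow> (real \<times> real) set" where
  "ellipse a b = {(x, y). (x / a)\<^sup>2 + (y / b)\<^sup>2 = 1}"

definition ellipse_param :: "real \<Rightarrow> real \<Rightarrow> real \<Rightarrow> real \<times> real" where
  "ellipse_param a b t = (a * cos t, b * sin t)"

definition perp_line :: "real \<times> real \<Rightarrow> real \<times> real \<Rightarrow> (real \<times> real) set" where
  "perp_line A v = {X. (X - A) \<bullet> v = 0}"

definition hybrid_pedal_generic ::
  "real \<Rightarrow> real \<Rightarrow> real \<times> real \<Rightarrow> real \<Rightarrow> real \<times> real" where
  "hybrid_pedal_generic a b M t =
     (THE Q. perp_line (ellipse_param a b t) (ellipse_param a b t - M)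
             \<inter> perp_line M (vector_derivative (ellipse_param a b) (at t)) = {Q})"

text \<open>All curves are functions on the whole real line, with period \<open>2 * pi\<close>. Hence the limit
  below is two-sided, even when the parameter of \<open>M\<close> is \<open>0\<close> (equivalently \<open>2 * pi\<close>).\<close>

definition hybrid_pedal :: "real \<Rightarrow> real \<Rightarrow> real \<times> real \<Rightarrow> real \<Rightarrow> real \<times> real" where
  "hybrid_pedal a b M t =
     (if ellipse_param a b t = M then Lim (at t) (hybrid_pedal_generic a b M)
      else hybrid_pedal_generic a b M t)"

text \<open>A one-parameter family of lines is given by equations \<open>F t Y = 0\<close>. A point \<open>Y\<close> of the
  envelope at parameter \<open>t\<close> is a solution of \<open>F = 0\<close> and \<open>\<partial>F/\<partial>t = 0\<close>.\<close>

definition envelope_point ::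
  "(real \<Rightarrow> real \<times> real \<Rightarrow> real) \<Rightarrow> real \<Rightarrow> real \<times> real \<Rightarrow> bool" where
  "envelope_point F t Y \<longleftrightarrow> F t Y = 0 \<and> ((\<lambda>s. F s Y) has_real_derivative 0) (at t)"

text \<open>For each \<open>s\<close>, the zero set of \<open>\<lambda>Y. (Y - X s) \<bullet> (X s - M)\<close> is \<open>perp_line (X s) (X s - M)\<close>.\<close>

definition negative_pedal :: "real \<times> real \<Rightarrow> (real \<Rightarrow> real \<times> real) \<Rightarrow> real \<Rightarrow> real \<times> real" where
  "negative_pedal M X t = (THE Y. envelope_point (\<lambda>s Y. (Y - X s) \<bullet> (X s - M)) t Y)"

definition pseudo_talbot :: "real \<Rightarrow> real \<Rightarrow> real \<times> real \<Rightarrow> real \<Rightarrow> real \<times> real" where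
  "pseudo_talbot a b M = negative_pedal M (hybrid_pedal a b M)"

text \<open>A relation rather than a function, so that closedness, differentiability and integrability
  are part of the assertion that the signed area is \<open>A\<close>.\<close>

definition has_signed_area ::
  "(real \<Rightarrow> real \<times> real) \<Rightarrow> real \<Rightarrow> real \<Rightarrow> real \<Rightarrow> bool" where
  "has_signed_area \<gamma> c d A \<longleftrightarrow>
     \<gamma> c = \<gamma> d \<and> \<gamma> differentiable_on {c..d} \<and>
     ((\<lambda>t. (fst (\<gamma> t) * snd (vector_derivative \<gamma> (at t within {c..d}))
            - snd (\<gamma> t) * fst (vector_derivative \<gamma> (at t within {c..d}))) / 2)
      has_integral A) {c..d}"

end

theory Submission
  imports Defs
begin

text \<open>Write \<open>M = P(u)\<close>, and let \<open>N(t) = (b cos t, a sin t)\<close>, a normal of the ellipse at \<open>P(t)\<close>.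
The point \<open>Q\<^sup>*(t)\<close> is \<open>M + f(t) N(t)\<close>, where \<open>f\<close> is the quotient of \<open>|P(t) - M|\<^sup>2\<close> by
\<open>N(t) \<bullet> (P(t) - M) = a b (1 - cos (t - u))\<close>. The factor \<open>1 - cos (t - u)\<close> also divides the
squared chord length, so it cancels, and with
\<open>p = a\<^sup>2 + b\<^sup>2\<close> and \<open>d = a\<^sup>2 - b\<^sup>2\<close> what remains is the trigonometric polynomial
\<open>f(t) = (p - d cos (t + u)) / (a b)\<close>. It is everywhere positive because \<open>|d| < p\<close>. Hence the curve has no
exceptional parameter (\<open>hybrid_pedal_eq\<close>).

The lines whose envelope is the pseudo Talbot curve have the equation
\<open>f(t) (N(t) \<bullet> (Y - M) - h(t)) = 0\<close> with \<open>h = f |N|\<^sup>2\<close>. As \<open>f\<close> never vanishes, it can be cancelled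
from this equation and its derivative, and the envelope is that of the lines
\<open>N(t) \<bullet> (Y - M) = h(t)\<close>. For \<open>a = b = 1\<close> this is the classical recovery of a curve from its
support function \<open>h\<close>; the ellipse only scales the two axes. As for
support functions, the area is \<open>1 / (2 a b)\<close> times the integral of \<open>h (h + h'')\<close>
(\<open>has_signed_area_elliptic_envelope\<close>), and the choice of the origin does not matter because the
curve is closed.

Finally \<open>|N|\<^sup>2 = (p - d cos 2t) / 2\<close>, so that \<open>2 a b h\<close> has the Fourier expansion
\<open>p\<^sup>2 - p d cos (t + u) + (d\<^sup>2/2) cos (t - u) - p d cos 2t + (d\<^sup>2/2) cos (3t + u)\<close>.
The operator \<open>h \<mapsto> h + h''\<close> multiplies the harmonic of frequency \<open>k\<close> by \<open>1 - k\<^sup>2\<close>. It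
kills frequency 1, which is the only one whose amplitude depends on \<open>M\<close>: in the
other harmonics \<open>u\<close> affects at most the phase, which orthogonality does not see. This is why the area is
the same for all \<open>M\<close>, namely \<open>\<pi> (2 p\<^sup>2 + d\<^sup>2) (p\<^sup>2 - 2 d\<^sup>2) / (8 a\<^sup>3 b\<^sup>3)\<close>.\<close>

section \<open>The hybrid pedal curve\<close>

definition ellipse_normal :: "real \<Rightarrow> real \<Rightarrow> real \<Rightarrow> real \<times> real" where
  "ellipse_normal a b t = (b * cos t, a * sin t)"

text \<open>For \<open>M\<close> the point of the ellipse with parameter \<open>u\<close>, this is the coefficient of the normal in
\<open>Q\<^sup>*(t) - M\<close>, already in the form that makes sense at \<open>t = u\<close>.\<close>

definition pedal_factor :: "real \<Rightarrow> real \<Rightarrow> real \<Rightarrow> real \<Rightarrow> real" where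
  "pedal_factor a b u t = (a\<^sup>2 + b\<^sup>2 - (a\<^sup>2 - b\<^sup>2) * cos (t + u)) / (a * b)"

text \<open>Positivity is what allows the factor to be cancelled from the equations of the envelope.\<close>

lemma pedal_factor_pos:
  assumes "a > 0" "b > 0"
  shows "pedal_factor a b u t > 0"
proof -
  have "a\<^sup>2 + b\<^sup>2 - (a\<^sup>2 - b\<^sup>2) * cos (t + u) = a\<^sup>2 * (1 - cos (t + u)) + b\<^sup>2 * (1 + cos (t + u))"
    by algebra
  moreover have "a\<^sup>2 * (1 - cos (t + u)) \<ge> 0" "b\<^sup>2 * (1 + cos (t + u)) \<ge> 0"
    using cos_le_one[of "t + u"] cos_ge_minus_one[of "t + u"]
    by (intro mult_nonneg_nonneg zero_le_power2; linarith)+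
  moreover have "a\<^sup>2 * (1 - cos (t + u)) > 0 \<or> b\<^sup>2 * (1 + cos (t + u)) > 0"
    using assms cos_le_one[of "t + u"]
    by (cases "cos (t + u) = 1") (auto intro!: mult_pos_pos)
  ultimately have "a\<^sup>2 + b\<^sup>2 - (a\<^sup>2 - b\<^sup>2) * cos (t + u) > 0"
    by linarith
  then show ?thesis
    using assms by (simp add: pedal_factor_def)
qed

lemma ellipse_param_eqI:
  assumes "cos (t - u) = 1"
  shows "ellipse_param a b t = ellipse_param a b u"
proof -
  have "sin (t - u) = 0"
    using assms sin_cos_squared_add[of "t - u"] by simp
  then have "cos ((t - u) + u) = cos u" "sin ((t - u) + u) = sin u"
    using assms by (simp_all only: cos_add sin_add)
  then show ?thesis
    by (simp add: ellipse_param_def)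
qed

lemma ellipse_param_eqD:
  assumes "a \<noteq> 0" "b \<noteq> 0" "ellipse_param a b t = ellipse_param a b u"
  shows "cos (t - u) = 1"
  using assms sin_cos_squared_add3[of u] by (simp add: ellipse_param_def cos_diff)

text \<open>The squared length of a chord has the same double zero \<open>1 - cos (t - u)\<close> at \<open>t = u\<close> as its inner
product with the normal, because each squared difference of coordinates splits:
\<open>cos t - cos u\<close> and \<open>sin t - sin u\<close> have the common factor \<open>sin ((t - u) / 2)\<close>. The remaining
factors \<open>2 sin\<^sup>2 ((t + u) / 2)\<close> and \<open>2 cos\<^sup>2 ((t + u) / 2)\<close> make up \<open>pedal_factor\<close>.\<close>

lemma chord_length_factor:
  assumes "a \<noteq> 0" "b \<noteq> 0"
  shows "(ellipse_param a b t - ellipse_param a b u) \<bullet> (ellipse_param a b t - ellipse_param a b u)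
       = pedal_factor a b u t * (a * b * (1 - cos (t - u)))"
proof -
  have "(cos t - cos u)\<^sup>2 = (1 - cos (t + u)) * (1 - cos (t - u))"
    unfolding cos_add cos_diff using sin_cos_squared_add[of t] sin_cos_squared_add[of u] by algebra
  moreover have "(sin t - sin u)\<^sup>2 = (1 + cos (t + u)) * (1 - cos (t - u))"
    unfolding cos_add cos_diff using sin_cos_squared_add[of t] sin_cos_squared_add[of u] by algebra
  moreover have "(ellipse_param a b t - ellipse_param a b u) \<bullet> (ellipse_param a b t - ellipse_param a b u)
      = a\<^sup>2 * (cos t - cos u)\<^sup>2 + b\<^sup>2 * (sin t - sin u)\<^sup>2"
    by (simp add: ellipse_param_def inner_prod_def) algebra
  moreover have "pedal_factor a b u t * (a * b * (1 - cos (t - u)))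
      = (a\<^sup>2 + b\<^sup>2 - (a\<^sup>2 - b\<^sup>2) * cos (t + u)) * (1 - cos (t - u))"
    using assms by (simp add: pedal_factor_def)
  ultimately show ?thesis
    by algebra
qed

lemma chord_inner_normal:
  "ellipse_normal a b t \<bullet> (ellipse_param a b t - ellipse_param a b u) = a * b * (1 - cos (t - u))"
proof -
  have "ellipse_normal a b t \<bullet> (ellipse_param a b t - ellipse_param a b u)
      = a * b * ((sin t)\<^sup>2 + (cos t)\<^sup>2 - (cos t * cos u + sin t * sin u))"
    unfolding ellipse_param_def ellipse_normal_def diff_Pair inner_Pair inner_real_def by algebra
  then show ?thesis
    by (simp add: cos_diff)
qed

lemma vector_derivative_ellipse_param:
  "vector_derivative (ellipse_param a b) (at t) = (- a * sin t, b * cos t)"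
  unfolding ellipse_param_def
  by (rule vector_derivative_at)
     (auto intro!: derivative_eq_intros has_vector_derivative_Pair 
        simp: has_real_derivative_iff_has_vector_derivative[symmetric])

lemma perp_line_tangent:
  assumes "a > 0" "b > 0"
  shows "Q \<in> perp_line M (vector_derivative (ellipse_param a b) (at t))
     \<longleftrightarrow> (\<exists>r. Q = M + r *\<^sub>R ellipse_normal a b t)"
proof
  assume "\<exists>r. Q = M + r *\<^sub>R ellipse_normal a b t"
  then show "Q \<in> perp_line M (vector_derivative (ellipse_param a b) (at t))"
    by (auto simp: perp_line_def vector_derivative_ellipse_param ellipse_normal_def inner_prod_def)
next
  assume *: "Q \<in> perp_line M (vector_derivative (ellipse_param a b) (at t))"
  obtain x y where xy: "Q - M = (x, y)" by (cases "Q - M")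
  define k where "k = (b * cos t)\<^sup>2 + (a * sin t)\<^sup>2"
  have "k \<noteq> 0"
    using assms sin_zero_abs_cos_one[of t] by (auto simp: k_def sum_power2_eq_zero_iff)
  have 0: "b * cos t * y = a * sin t * x"
    using * unfolding perp_line_def mem_Collect_eq xy vector_derivative_ellipse_param inner_Pair
    by (simp add: mult_ac)
  define r where "r = (b * cos t * x + a * sin t * y) / k"
  have rk: "r * k = b * cos t * x + a * sin t * y"
    using \<open>k \<noteq> 0\<close> by (simp add: r_def)
  have "(r * (b * cos t)) * k = x * k" "(r * (a * sin t)) * k = y * k"
    using 0 rk unfolding k_def by algebra+
  then have "Q - M = r *\<^sub>R ellipse_normal a b t"
    using \<open>k \<noteq> 0\<close> xy by (simp add: ellipse_normal_def)
  then show "\<exists>r. Q = M + r *\<^sub>R ellipse_normal a b t"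
    by (metis add.commute diff_add_cancel)
qed

lemma hybrid_pedal_generic_eq:
  assumes "a > 0" "b > 0" "ellipse_param a b t \<noteq> ellipse_param a b u"
  shows "hybrid_pedal_generic a b (ellipse_param a b u) t
       = ellipse_param a b u + pedal_factor a b u t *\<^sub>R ellipse_normal a b t"
proof -
  define c where "c = a * b * (1 - cos (t - u))"
  have c: "c \<noteq> 0"
    using assms ellipse_param_eqI[of t u a b] by (auto simp: c_def)
  define P M N where "P = ellipse_param a b t" and "M = ellipse_param a b u"
    and "N = ellipse_normal a b t"
  have on_line: "M + r *\<^sub>R N \<in> perp_line P (P - M) \<longleftrightarrow> r = pedal_factor a b u t" for r
  proof -
    have "(M + r *\<^sub>R N - P) \<bullet> (P - M) = r * (N \<bullet> (P - M)) - (P - M) \<bullet> (P - M)"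
      by (simp add: algebra_simps inner_commute)
    also have "\<dots> = (r - pedal_factor a b u t) * c"
      using assms chord_length_factor[of a b t u] chord_inner_normal[of a b t u]
      by (simp add: P_def M_def N_def c_def left_diff_distrib)
    finally show ?thesis
      using c by (simp add: perp_line_def)
  qed
  have "perp_line P (P - M) \<inter> perp_line M (vector_derivative (ellipse_param a b) (at t))
      = {M + pedal_factor a b u t *\<^sub>R N}"
    using on_line perp_line_tangent[OF assms(1,2), of _ M t] by (auto simp: N_def)
  then show ?thesis
    unfolding hybrid_pedal_generic_def P_def[symmetric] M_def[symmetric] N_def[symmetric] by auto
qed

lemma eventually_ellipse_param_neq:
  assumes "a > 0" "b > 0"
  shows "\<forall>\<^sub>F s in at t. ellipse_param a b s \<noteq> ellipse_param a b t"
  unfolding eventually_at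
proof (intro exI[of _ pi] conjI ballI impI)
  fix s assume "s \<noteq> t \<and> dist s t < pi"
  then have "cos \<bar>s - t\<bar> < cos 0"
    by (intro cos_monotone_0_pi) (auto simp: dist_real_def)
  then show "ellipse_param a b s \<noteq> ellipse_param a b t"
    using assms ellipse_param_eqD[of a b s t] by auto
qed simp

text \<open>At \<open>P(t) = M\<close> the limit exists because the formula of \<open>hybrid_pedal_generic_eq\<close> holds at all
nearby parameters and its right-hand side is continuous.\<close>

lemma hybrid_pedal_eq:
  assumes "a > 0" "b > 0"
  shows "hybrid_pedal a b (ellipse_param a b u) t
       = ellipse_param a b u + pedal_factor a b u t *\<^sub>R ellipse_normal a b t"
proof (cases "ellipse_param a b t = ellipse_param a b u")
  case True
  define Q where "Q s = ellipse_param a b u + pedal_factor a b u s *\<^sub>R ellipse_normal a b s" for s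
  have "\<forall>\<^sub>F s in at t. Q s = hybrid_pedal_generic a b (ellipse_param a b u) s"
    using eventually_ellipse_param_neq[OF assms, of t]
    by eventually_elim (use True hybrid_pedal_generic_eq[OF assms] in \<open>simp add: Q_def\<close>)
  moreover have "(Q \<longlongrightarrow> Q t) (at t)"
    using assms unfolding Q_def pedal_factor_def ellipse_normal_def by (intro tendsto_intros) auto
  ultimately have "(hybrid_pedal_generic a b (ellipse_param a b u) \<longlongrightarrow> Q t) (at t)"
    by (rule Lim_transform_eventually[rotated])
  then have "Lim (at t) (hybrid_pedal_generic a b (ellipse_param a b u)) = Q t"
    by (intro tendsto_Lim) auto
  then show ?thesis
    using True by (simp add: hybrid_pedal_def Q_def)
qed (use assms in \<open>simp add: hybrid_pedal_def hybrid_pedal_generic_eq\<close>)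

section \<open>Envelopes of lines with elliptic normals\<close>

text \<open>The envelope of the lines \<open>ellipse_normal a b t \<bullet> (Y - M) = h t\<close>, for \<open>h'\<close> the derivative of \<open>h\<close>: it
solves the linear system formed by this equation and its derivative in \<open>t\<close>.\<close>

definition elliptic_envelope ::
  "real \<Rightarrow> real \<Rightarrow> real \<times> real \<Rightarrow> (real \<Rightarrow> real) \<Rightarrow> (real \<Rightarrow> real) \<Rightarrow> real \<Rightarrow> real \<times> real" where
  "elliptic_envelope a b M h h' t
     = M + ((h t * cos t - h' t * sin t) / b, (h t * sin t + h' t * cos t) / a)"

text \<open>The line through \<open>X s\<close> perpendicular to \<open>X s - M\<close> has the equation \<open>f s * g s = 0\<close> with \<open>g\<close>
free of \<open>f\<close>. Where \<open>f\<close> does not vanish, \<open>f g = 0\<close> and \<open>(f g)' = 0\<close> together say the same as \<open>g = 0\<close>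
and \<open>g' = 0\<close>, a linear system with determinant \<open>a b\<close>.\<close>

lemma negative_pedal_eq_elliptic_envelope:
  assumes ab: "a \<noteq> 0" "b \<noteq> 0"
    and X: "\<And>s. X s = M + f s *\<^sub>R ellipse_normal a b s"
    and f: "f t \<noteq> 0" "(f has_real_derivative f') (at t)"
    and h: "\<And>s. h s = f s * (ellipse_normal a b s \<bullet> ellipse_normal a b s)"
    and h': "(h has_real_derivative h' t) (at t)"
  shows "negative_pedal M X t = elliptic_envelope a b M h h' t"
proof -
  have env: "envelope_point (\<lambda>s Y. (Y - X s) \<bullet> (X s - M)) t Y
      \<longleftrightarrow> Y = elliptic_envelope a b M h h' t" for Y
  proof -
    obtain x y where xy: "Y - M = (x, y)" by (cases "Y - M")
    define g where "g s = x * (b * cos s) + y * (a * sin s) - h s" for s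
    define g' where "g' = y * (a * cos t) - x * (b * sin t) - h' t"
    have g': "(g has_real_derivative g') (at t)"
      unfolding g_def g'_def by (rule derivative_eq_intros h' refl | simp)+
    have "(\<lambda>s. (Y - X s) \<bullet> (X s - M)) = (\<lambda>s. f s * g s)"
    proof
      fix s
      have "(Y - X s) \<bullet> (X s - M) = f s * ((Y - M) \<bullet> ellipse_normal a b s - h s)"
        by (simp add: X h algebra_simps)
      then show "(Y - X s) \<bullet> (X s - M) = f s * g s"
        by (simp add: xy g_def ellipse_normal_def inner_prod_def)
    qed
    moreover have "((\<lambda>s. f s * g s) has_real_derivative f' * g t + g' * f t) (at t)"
      using DERIV_mult[OF f(2) g'] by (simp add: add.commute)
    ultimately have "envelope_point (\<lambda>s Y. (Y - X s) \<bullet> (X s - M)) t Y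
        \<longleftrightarrow> f t * g t = 0 \<and> f' * g t + g' * f t = 0"
      unfolding envelope_point_def fun_eq_iff by (auto dest: DERIV_unique)
    also have "\<dots> \<longleftrightarrow> g t = 0 \<and> g' = 0"
      using f(1) by auto
    also have "\<dots> \<longleftrightarrow> b * x = h t * cos t - h' t * sin t \<and> a * y = h t * sin t + h' t * cos t"
      unfolding g_def g'_def using sin_cos_squared_add[of t] by algebra
    also have "\<dots> \<longleftrightarrow> Y - M = elliptic_envelope a b M h h' t - M"
      using ab by (simp add: xy elliptic_envelope_def field_simps)
    finally show ?thesis by simp
  qed
  then show ?thesis
    unfolding negative_pedal_def env by simp
qed

text \<open>In the derivative of the envelope the terms with \<open>h'\<close> cancel, and what is left is \<open>h + h''\<close> times
the vector \<open>(- sin t / b, cos t / a)\<close>, parallel to the line at \<open>t\<close>. The cross product of the position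
relative to \<open>M\<close> with it is \<open>h (h + h'') / (a b)\<close>. The contribution of \<open>M\<close> itself is linear in
the derivative, hence integrates to zero over a closed curve.\<close>

lemma has_signed_area_elliptic_envelope:
  assumes ab: "a \<noteq> 0" "b \<noteq> 0"
    and h: "\<And>t. (h has_real_derivative h' t) (at t)"
    and h': "\<And>t. (h' has_real_derivative h'' t) (at t)"
    and period: "h (2 * pi) = h 0" "h' (2 * pi) = h' 0"
    and A: "((\<lambda>t. h t * (h t + h'' t)) has_integral 2 * a * b * A) {0..2 * pi}"
  shows "has_signed_area (elliptic_envelope a b M h h') 0 (2 * pi) A"
proof -
  define \<gamma> where "\<gamma> = elliptic_envelope a b M h h'"
  define d where "d t = (- (h t + h'' t) * sin t / b, (h t + h'' t) * cos t / a)" for t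
  have closed: "\<gamma> 0 = \<gamma> (2 * pi)"
    using period by (simp add: \<gamma>_def elliptic_envelope_def)
  have deriv: "(\<gamma> has_vector_derivative d t) (at t within S)" for t S
  proof -
    have "((\<lambda>t. (h t * cos t - h' t * sin t) / b) has_real_derivative - (h t + h'' t) * sin t / b)
        (at t within S)"
      by (rule derivative_eq_intros DERIV_subset[OF h subset_UNIV] DERIV_subset[OF h' subset_UNIV]
            refl | use ab in \<open>simp add: field_simps; fail\<close>)+
    moreover have "((\<lambda>t. (h t * sin t + h' t * cos t) / a) has_real_derivative
        (h t + h'' t) * cos t / a) (at t within S)"
      by (rule derivative_eq_intros DERIV_subset[OF h subset_UNIV] DERIV_subset[OF h' subset_UNIV]
            refl | use ab in \<open>simp add: field_simps; fail\<close>)+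
    ultimately show ?thesis
      unfolding \<gamma>_def elliptic_envelope_def[abs_def] d_def has_real_derivative_iff_has_vector_derivative
      using has_vector_derivative_add[OF has_vector_derivative_const has_vector_derivative_Pair]
      by fastforce
  qed
  have vd: "vector_derivative \<gamma> (at t within {0..2 * pi}) = d t" if "t \<in> {0..2 * pi}" for t
    using that deriv by (intro vector_derivative_within_cbox[of 0 "2 * pi", simplified]) auto
  have diff: "\<gamma> differentiable_on {0..2 * pi}"
    unfolding differentiable_on_def using deriv differentiableI_vector by blast
  have "(d has_integral \<gamma> (2 * pi) - \<gamma> 0) {0..2 * pi}"
    using deriv by (intro fundamental_theorem_of_calculus) auto
  then have d0: "(d has_integral 0) {0..2 * pi}"
    using closed by simp
  have "((\<lambda>t. (fst M * snd (d t) - snd M * fst (d t)) / 2) has_integral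
        (fst M * snd 0 - snd M * fst 0) / 2) {0..2 * pi}"
    using has_integral_linear[OF d0 bounded_linear_fst] has_integral_linear[OF d0 bounded_linear_snd]
    by (intro has_integral_divide has_integral_diff has_integral_mult_right) (auto simp: o_def)
  from has_integral_add[OF this has_integral_divide[OF A, of "2 * a * b"]]
  have "((\<lambda>t. (fst M * snd (d t) - snd M * fst (d t)) / 2 + h t * (h t + h'' t) / (2 * a * b))
      has_integral A) {0..2 * pi}"
    using ab by simp
  then have "((\<lambda>t. (fst (\<gamma> t) * snd (vector_derivative \<gamma> (at t within {0..2 * pi}))
            - snd (\<gamma> t) * fst (vector_derivative \<gamma> (at t within {0..2 * pi}))) / 2)
      has_integral A) {0..2 * pi}"
  proof (rule has_integral_eq[rotated])
    fix t :: real assume t: "t \<in> {0..2 * pi}"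
    define x y where "x = (h t * cos t - h' t * sin t) / b" and "y = (h t * sin t + h' t * cos t) / a"
    have "(h t * cos t - h' t * sin t) * ((h t + h'' t) * cos t)
        - (h t * sin t + h' t * cos t) * (- (h t + h'' t) * sin t) = h t * (h t + h'' t)"
      using sin_cos_squared_add[of t] by algebra
    then have cross: "x * snd (d t) - y * fst (d t) = h t * (h t + h'' t) / (a * b)"
      by (simp only: x_def y_def d_def fst_conv snd_conv times_divide_times_eq
            mult.commute[of b a] diff_divide_distrib[symmetric])
    have "(fst M * snd (d t) - snd M * fst (d t)) / 2 + h t * (h t + h'' t) / (2 * a * b)
        = ((fst M + x) * snd (d t) - (snd M + y) * fst (d t)) / 2"
      using arg_cong[OF cross, of "\<lambda>z. z / 2"]
      by (simp add: algebra_simps add_divide_distrib diff_divide_distrib)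
    then show "(fst M * snd (d t) - snd M * fst (d t)) / 2 + h t * (h t + h'' t) / (2 * a * b) =
         (fst (\<gamma> t) * snd (vector_derivative \<gamma> (at t within {0..2 * pi}))
            - snd (\<gamma> t) * fst (vector_derivative \<gamma> (at t within {0..2 * pi}))) / 2"
      unfolding vd[OF t] by (simp add: \<gamma>_def elliptic_envelope_def x_def y_def)
  qed
  then show ?thesis
    unfolding has_signed_area_def \<gamma>_def[symmetric] using closed diff by blast
qed

section \<open>The area integral\<close>

lemma has_integral_cos_harmonic:
  fixes k :: int
  assumes "k \<noteq> 0"
  shows "((\<lambda>t. cos (k * t + c)) has_integral 0) {0..2 * pi}"
proof -
  have "((\<lambda>t. cos (k * t + c)) has_integral
      sin (k * (2 * pi) + c) / k - sin (real_of_int k * 0 + c) / k) {0..2 * pi}"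
    using assms
    by (intro fundamental_theorem_of_calculus)
       (auto intro!: derivative_eq_intros 
          simp: has_real_derivative_iff_has_vector_derivative[symmetric])
  moreover have "sin (k * (2 * pi) + c) = sin c"
    using sin_int_2pin[of k] cos_int_2pin[of k] by (simp add: sin_add mult_ac)
  ultimately show ?thesis by simp
qed

lemma has_integral_cos_cos:
  fixes k m :: nat
  shows "((\<lambda>t. cos (k * t + c) * cos (m * t + e)) has_integral
      (if k \<noteq> m then 0 else if k = 0 then 2 * pi * cos c * cos e else pi * cos (c - e))) {0..2 * pi}"
proof -
  have const: "((\<lambda>t. x) has_integral 2 * pi * x) {0..2 * pi}" for x :: real
    using has_integral_const_real[of x 0 "2 * pi"] by simp
  have product_to_sum: "cos (k * t + c) * cos (m * t + e)
      = (cos (of_int (int k - int m) * t + (c - e)) + cos (of_int (int k + int m) * t + (c + e))) / 2"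
    for t :: real
    by (simp add: cos_times_cos algebra_simps)
  have half: "((\<lambda>t. cos (k * t + c) * cos (m * t + e)) has_integral (I + J) / 2) {0..2 * pi}"
    if "((\<lambda>t. cos (of_int (int k - int m) * t + (c - e))) has_integral I) {0..2 * pi}"
       "((\<lambda>t. cos (of_int (int k + int m) * t + (c + e))) has_integral J) {0..2 * pi}" for I J
    using has_integral_divide[OF has_integral_add[OF that], of 2] by (simp only: product_to_sum)
  consider "k \<noteq> m" | "k = m" "k \<noteq> 0" | "k = 0" "m = 0" by auto
  then show ?thesis
  proof cases
    case 1
    then show ?thesis
      using half[OF has_integral_cos_harmonic has_integral_cos_harmonic] by simp
  next
    case 2
    then show ?thesis
      using half[OF _ has_integral_cos_harmonic, of "2 * pi * cos (c - e)"] const by simp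
  next
    case 3
    then show ?thesis
      using const[of "cos c * cos e"] by (simp add: mult.assoc)
  qed
qed

text \<open>For the pseudo Talbot curve, \<open>2 a b\<close> times its support function is \<open>h\<close>, and the other factor is
\<open>h + h''\<close>. That factor only has the frequencies 0, 2 and 3, so it suffices to know the
Fourier coefficients of \<open>h\<close> there.\<close>

lemma has_integral_support_product:
  fixes p d u :: real
  defines "h \<equiv> \<lambda>t. (p - d * cos (t + u)) * (p - d * cos (2 * t))"
  shows "((\<lambda>t. h t * (p\<^sup>2 + 3 * p * d * cos (2 * t) - 4 * d\<^sup>2 * cos (3 * t + u))) has_integral
      pi * (2 * p\<^sup>2 + d\<^sup>2) * (p\<^sup>2 - 2 * d\<^sup>2)) {0..2 * pi}"
proof -
  have fourier: "h t = p\<^sup>2 * cos (0 * t + 0) - p * d * cos (1 * t + u) - p * d * cos (2 * t + 0)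
      + d\<^sup>2 / 2 * cos (3 * t + u) + d\<^sup>2 / 2 * cos (1 * t - u)" for t
  proof -
    have "cos (t + u) * cos (2 * t) = (cos (3 * t + u) + cos (t - u)) / 2"
      using cos_times_cos[of "2 * t" "t + u"] by (simp add: algebra_simps)
    then show ?thesis
      by (simp add: h_def) algebra
  qed
  \<comment> \<open>The Fourier coefficients of \<open>h\<close>. The frequency 1 occurs twice in \<open>h\<close>, with the phases \<open>u\<close> and \<open>- u\<close>.\<close>
  have *: "((\<lambda>t. h t * cos (real m * t + e)) has_integral
      (p\<^sup>2 * (if m = 0 then 2 * pi * cos e else 0)
        - p * d * (if m = 1 then pi * cos (u - e) else 0)
        - p * d * (if m = 2 then pi * cos e else 0)
        + d\<^sup>2 / 2 * (if m = 3 then pi * cos (u - e) else 0)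
        + d\<^sup>2 / 2 * (if m = 1 then pi * cos (- u - e) else 0))) {0..2 * pi}" for m e
  proof -
    have "((\<lambda>t. p\<^sup>2 * (cos (real 0 * t + 0) * cos (real m * t + e))
        - p * d * (cos (real 1 * t + u) * cos (real m * t + e))
        - p * d * (cos (real 2 * t + 0) * cos (real m * t + e))
        + d\<^sup>2 / 2 * (cos (real 3 * t + u) * cos (real m * t + e))
        + d\<^sup>2 / 2 * (cos (real 1 * t + - u) * cos (real m * t + e))) has_integral
      (p\<^sup>2 * (if 0 \<noteq> m then 0 else if (0::nat) = 0 then 2 * pi * cos 0 * cos e else pi * cos (0 - e))
        - p * d * (if 1 \<noteq> m then 0 else if (1::nat) = 0 then 2 * pi * cos u * cos e else pi * cos (u - e))
        - p * d * (if 2 \<noteq> m then 0 else if (2::nat) = 0 then 2 * pi * cos 0 * cos e else pi * cos (0 - e))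
        + d\<^sup>2 / 2 * (if 3 \<noteq> m then 0 else if (3::nat) = 0 then 2 * pi * cos u * cos e else pi * cos (u - e))
        + d\<^sup>2 / 2 * (if 1 \<noteq> m then 0 else if (1::nat) = 0 then 2 * pi * cos (- u) * cos e
            else pi * cos (- u - e)))) {0..2 * pi}"
      by (intro has_integral_add has_integral_diff has_integral_mult_right has_integral_cos_cos)
    then show ?thesis
      by (rule has_integral_eq_rhs[OF has_integral_eq[rotated]]) (auto simp: fourier algebra_simps)
  qed
  have "((\<lambda>t. p\<^sup>2 * (h t * cos (real 0 * t + 0)) + 3 * p * d * (h t * cos (real 2 * t + 0))
      - 4 * d\<^sup>2 * (h t * cos (real 3 * t + u))) has_integral
      p\<^sup>2 * (p\<^sup>2 * (2 * pi)) + 3 * p * d * (- p * d * pi) - 4 * d\<^sup>2 * (d\<^sup>2 / 2 * pi)) {0..2 * pi}"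
    using *[of 0 0] *[of 2 0] *[of 3 u]
    by (intro has_integral_add has_integral_diff has_integral_mult_right) simp_all
  moreover have "p\<^sup>2 * (p\<^sup>2 * (2 * pi)) + 3 * p * d * (- p * d * pi) - 4 * d\<^sup>2 * (d\<^sup>2 / 2 * pi)
      = pi * (2 * p\<^sup>2 + d\<^sup>2) * (p\<^sup>2 - 2 * d\<^sup>2)"
    by (simp add: field_simps power2_eq_square)
  ultimately show ?thesis
    by (simp add: algebra_simps)
qed

lemma ellipse_param_surj:
  assumes "a \<noteq> 0" "b \<noteq> 0" "M \<in> ellipse a b"
  obtains u where "M = ellipse_param a b u"
proof -
  obtain x y where M: "M = (x, y)" by (cases M)
  obtain u where "x / a = cos u" "y / b = sin u"
    using assms(3) sincos_total_2pi[of "x / a" "y / b"] by (auto simp: M ellipse_def)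
  then show ?thesis
    using that[of u] assms(1,2) by (simp add: M ellipse_param_def field_simps)
qed

theorem theorem3:
  fixes a b :: real and M :: "real \<times> real"
  assumes "a > 0" and "b > 0"
    and "M \<in> ellipse a b"
  shows "has_signed_area (pseudo_talbot a b M) 0 (2 * pi)
           (- (pi * (3 * a ^ 4 + 2 * a\<^sup>2 * b\<^sup>2 + 3 * b ^ 4)
                 * (a\<^sup>2 - 2 * a * b - b\<^sup>2) * (a\<^sup>2 + 2 * a * b - b\<^sup>2)
               / (8 * a ^ 3 * b ^ 3)))"
    (is "has_signed_area _ _ _ ?A")
proof -
  obtain u where M: "M = ellipse_param a b u"
    using ellipse_param_surj[of a b M] assms by auto
  define p d where "p = a\<^sup>2 + b\<^sup>2" and "d = a\<^sup>2 - b\<^sup>2"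
  \<comment> \<open>The common denominator: \<open>a b\<close> from \<open>pedal_factor\<close> and 2 from the squared length of the normal.\<close>
  define k where "k = 2 * a * b"
  have k: "k \<noteq> 0" using assms by (simp add: k_def)
  define h where "h t = (p - d * cos (t + u)) * (p - d * cos (2 * t)) / k" for t
  define h' where "h' t = (d * sin (t + u) * (p - d * cos (2 * t))
      + (p - d * cos (t + u)) * (2 * d * sin (2 * t))) / k" for t
  define h'' where "h'' t = (d * cos (t + u) * (p - d * cos (2 * t))
      + 4 * d\<^sup>2 * sin (t + u) * sin (2 * t) + (p - d * cos (t + u)) * (4 * d * cos (2 * t))) / k" for t
  have h': "(h has_real_derivative h' t) (at t)" for t
    unfolding h_def h'_def using k
    by (auto intro!: derivative_eq_intros simp: field_simps)
  have h'': "(h' has_real_derivative h'' t) (at t)" for t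
    unfolding h''_def h'_def using k
    by (auto intro!: derivative_eq_intros simp: field_simps power2_eq_square)
  have "pseudo_talbot a b M t = elliptic_envelope a b M h h' t" for t
    unfolding pseudo_talbot_def
  proof (rule negative_pedal_eq_elliptic_envelope)
    show "hybrid_pedal a b M s = M + pedal_factor a b u s *\<^sub>R ellipse_normal a b s" for s
      unfolding M by (rule hybrid_pedal_eq[OF assms(1,2)])
    show "pedal_factor a b u t \<noteq> 0"
      using pedal_factor_pos[OF assms(1,2), of u t] by simp
    show "(pedal_factor a b u has_real_derivative d * sin (t + u) / (a * b)) (at t)"
      unfolding pedal_factor_def[abs_def] d_def using assms
      by (auto intro!: derivative_eq_intros simp: field_simps)
    show "h s = pedal_factor a b u s * (ellipse_normal a b s \<bullet> ellipse_normal a b s)" for s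
    proof -
      have normal_square: "ellipse_normal a b s \<bullet> ellipse_normal a b s = (p - d * cos (2 * s)) / 2"
        unfolding cos_double p_def d_def ellipse_normal_def
        using sin_cos_squared_add[of s] unfolding inner_Pair inner_real_def
        by algebra
      show ?thesis
        unfolding h_def pedal_factor_def k_def normal_square by (simp add: p_def d_def)
    qed
  qed (use assms h' in auto)
  then have "pseudo_talbot a b M = elliptic_envelope a b M h h'" ..
  moreover have "has_signed_area (elliptic_envelope a b M h h') 0 (2 * pi) ?A"
  proof (rule has_signed_area_elliptic_envelope[OF _ _ h' h''])
    \<comment> \<open>The harmonics of frequency 1 have disappeared; the others carry the factors 1, -3 and -8.\<close>
    have "h t + h'' t = (p\<^sup>2 + 3 * p * d * cos (2 * t) - 4 * d\<^sup>2 * cos (3 * t + u)) / k" for t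
    proof -
      have "cos (3 * t + u) = cos (t + u) * cos (2 * t) - sin (t + u) * sin (2 * t)"
        using cos_add[of "t + u" "2 * t"] by (simp add: algebra_simps)
      then show ?thesis
        unfolding h_def h''_def add_divide_distrib[symmetric]
        by (intro arg_cong[of _ _ "\<lambda>x. x / k"]) algebra
    qed
    then have eq: "(\<lambda>t. h t * (h t + h'' t)) = (\<lambda>t. (p - d * cos (t + u)) * (p - d * cos (2 * t))
        * (p\<^sup>2 + 3 * p * d * cos (2 * t) - 4 * d\<^sup>2 * cos (3 * t + u)) / k\<^sup>2)"
      by (simp add: h_def power2_eq_square)
    have "pi * (2 * p\<^sup>2 + d\<^sup>2) * (p\<^sup>2 - 2 * d\<^sup>2) / k\<^sup>2 = 2 * a * b * ?A"
    proof -
      have "2 * p\<^sup>2 + d\<^sup>2 = 3 * a ^ 4 + 2 * a\<^sup>2 * b\<^sup>2 + 3 * b ^ 4"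
        unfolding p_def d_def by algebra
      moreover have "p\<^sup>2 - 2 * d\<^sup>2 = - ((a\<^sup>2 - 2 * a * b - b\<^sup>2) * (a\<^sup>2 + 2 * a * b - b\<^sup>2))"
        unfolding p_def d_def by algebra
      ultimately show ?thesis
        using assms by (simp add: k_def power2_eq_square power3_eq_cube mult_ac)
    qed
    then show "((\<lambda>t. h t * (h t + h'' t)) has_integral 2 * a * b * ?A) {0..2 * pi}"
      unfolding eq
      using has_integral_divide[OF has_integral_support_product[of p d u], of "k\<^sup>2"] by simp
    have c4: "cos (2 * (2 * pi)) = 1" "sin (2 * (2 * pi)) = 0"
      using cos_double[of "2 * pi"] sin_double[of "2 * pi"] by simp_all
    show "h (2 * pi) = h 0" "h' (2 * pi) = h' 0"
      by (simp_all add: h_def h'_def c4 cos_add sin_add)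
  qed (use assms in auto)
  ultimately show ?thesis by simp
qed

end
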